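(* Let $H\in\mathbb R^{m\times n}$ and $H'\in\mathbb R^{m'\times n'}$ be non-zero matrices, and let $d$ be one of the metrics $d_\kappa$ (chordal), $d_\gamma$ (Grassmann), $d_\pi$ (Procrustes). Then $$d(\operatorname{im}(HP),\operatorname{im}(H'P'))=d(\operatorname{im}H,\operatorname{im}H')$$ for all invertible $P\in\mathbb R^{n\times n}$ and $P'\in\mathbb R^{n'\times n'}$.
   Context: $\operatorname{im}M$ denotes the image (column space) of a matrix $M$. For finite-dimensional subspaces $\mathcal V\subseteq\mathbb R^N$, $\mathcal U\subseteq\mathbb R^{N'}$ with $k=\dim\mathcal V$, $l=\dim\mathcal U$, the principal angles $\theta_i=\theta_i(\mathcal V,\mathcal U)\in[0,\pi/2]$, $i=1,\dots,\min(k,l)$, are the usual ones, computed after embedding both subspaces in a common $\mathbb R^M$ by appending zero coordinates. The metrics are $$d_\kappa(\mathcal V,\mathcal U)=\Big(|k-l|+\sum_{i=1}^{\min(k,l)}(\sin\theta_i)^2\Big)^{1/2},$$ $$d_\gamma(\mathcal V,\mathcal U)=\Big(|k-l|\tfrac{\pi^2}{4}+\sum_{i=1}^{\min(k,l)}\theta_i^2\Big)^{1/2},$$ $$d_\pi(\mathcal V,\mathcal U)=\Big(|k-l|+2\sum_{i=1}^{\min(k,l)}\big(\sin\tfrac{\theta_i}{2}\big)^2\Big)^{1/2}.$$ *)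

theory Defs
  imports Complex_Main "Jordan_Normal_Form.VS_Connect"
begin

text \<open>
  A subspace of \<open>\<real>\<^sup>N\<close> is a set \<open>V \<subseteq> carrier_vec N\<close> of real vectors; since the set alone does not
  carry \<open>N\<close> as data, the functions below take the ambient dimension as an extra argument.
\<close>

abbreviation im :: "real mat \<Rightarrow> real vec set" where
  "im A \<equiv> vec_space.col_space (dim_row A) A"

definition subspace_dim :: "nat \<Rightarrow> real vec set \<Rightarrow> nat" where
  "subspace_dim N V = vectorspace.dim class_ring ((module_vec TYPE(real) N)\<lparr>carrier := V\<rparr>)"

definition zero_pad :: "nat \<Rightarrow> real vec \<Rightarrow> real vec" where
  "zero_pad M v = v @\<^sub>v 0\<^sub>v (M - dim_vec v)"

definition principal_candidates ::
    "real vec set \<Rightarrow> real vec set \<Rightarrow> (nat \<Rightarrow> real vec) \<Rightarrow> (nat \<Rightarrow> real vec) \<Rightarrow> nat \<Rightarrow>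
     (real vec \<times> real vec) set" where
  "principal_candidates V U p q i =
     {(u, v). u \<in> V \<and> v \<in> U \<and> u \<bullet> u = 1 \<and> v \<bullet> v = 1 \<and>
        (\<forall>j\<in>{1..<i}. u \<bullet> p j = 0 \<and> v \<bullet> q j = 0)}"

text \<open>
  The recursive definition of principal vectors: \<open>(p i, q i)\<close> maximises \<open>u \<bullet> v\<close> over all unit
  vectors \<open>u \<in> V\<close>, \<open>v \<in> U\<close> orthogonal to the principal vectors already chosen in the same subspace.
\<close>

definition principal_vectors ::
    "real vec set \<Rightarrow> real vec set \<Rightarrow> nat \<Rightarrow> (nat \<Rightarrow> real vec) \<Rightarrow> (nat \<Rightarrow> real vec) \<Rightarrow> bool" where
  "principal_vectors V U r p q \<longleftrightarrow>
     (\<forall>i\<in>{1..r}. (p i, q i) \<in> principal_candidates V U p q i \<and>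
        (\<forall>(u, v)\<in>principal_candidates V U p q i. u \<bullet> v \<le> p i \<bullet> q i))"

text \<open>
  Principal vectors are not unique, but for \<open>1 \<le> i \<le> min (dim V) (dim U)\<close> they exist and the
  numbers \<open>p i \<bullet> q i\<close> (the singular values of the product \<open>A\<^sup>T B\<close> of matrices whose columns are
  orthonormal bases of \<open>V\<close> and \<open>U\<close>) do not depend on the choice; nor do they depend on which
  common space \<open>\<real>\<^sup>M\<close>, \<open>M \<ge> max N N'\<close>, the two subspaces are embedded in.
\<close>

definition principal_angle ::
    "nat \<Rightarrow> real vec set \<Rightarrow> nat \<Rightarrow> real vec set \<Rightarrow> nat \<Rightarrow> real" where
  "principal_angle N V N' U i =
     (let M = max N N';
          (p, q) = (SOME (p, q). principal_vectors (zero_pad M ` V) (zero_pad M ` U)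
                      (min (subspace_dim N V) (subspace_dim N' U)) p q)
      in arccos (p i \<bullet> q i))"

definition dist_chordal :: "nat \<Rightarrow> real vec set \<Rightarrow> nat \<Rightarrow> real vec set \<Rightarrow> real" where
  "dist_chordal N V N' U =
     (let k = subspace_dim N V; l = subspace_dim N' U
      in sqrt (\<bar>real k - real l\<bar> + (\<Sum>i=1..min k l. (sin (principal_angle N V N' U i))\<^sup>2)))"

definition dist_grassmann :: "nat \<Rightarrow> real vec set \<Rightarrow> nat \<Rightarrow> real vec set \<Rightarrow> real" where
  "dist_grassmann N V N' U =
     (let k = subspace_dim N V; l = subspace_dim N' U
      in sqrt (\<bar>real k - real l\<bar> * (pi\<^sup>2 / 4) + (\<Sum>i=1..min k l. (principal_angle N V N' U i)\<^sup>2)))"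

definition dist_procrustes :: "nat \<Rightarrow> real vec set \<Rightarrow> nat \<Rightarrow> real vec set \<Rightarrow> real" where
  "dist_procrustes N V N' U =
     (let k = subspace_dim N V; l = subspace_dim N' U
      in sqrt (\<bar>real k - real l\<bar> +
           2 * (\<Sum>i=1..min k l. (sin (principal_angle N V N' U i / 2))\<^sup>2)))"

end

theory Submission
  imports Defs
begin

text \<open>
  Each of the three distances depends on a matrix only through its image, and right
  multiplication by an invertible matrix does not change the image. Indeed
  \<open>(A * B) x = A (B x)\<close> gives \<open>im (A * B) \<subseteq> im A\<close> for every \<open>B\<close>
  (\<open>im_mult_subset\<close>), and the same inclusion for \<open>A = (A * P) * P\<^sup>-\<^sup>1\<close> gives the converse
  (\<open>im_mult_invertible\<close>).
\<close>

lemma im_eq_range: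
  assumes "A \<in> carrier_mat m n"
  shows "im A = {A *\<^sub>v x | x. x \<in> carrier_vec n}"
  using vec_space.col_space_eq[OF assms] assms by auto

lemma im_mult_subset:
  assumes A: "A \<in> carrier_mat m n" and B: "B \<in> carrier_mat n k"
  shows "im (A * B) \<subseteq> im A"
proof
  fix y assume "y \<in> im (A * B)"
  then obtain x where x: "x \<in> carrier_vec k" and y: "y = A * B *\<^sub>v x"
    using im_eq_range[OF mult_carrier_mat[OF A B]] by auto
  have "y = A *\<^sub>v (B *\<^sub>v x)"
    using y assoc_mult_mat_vec[OF A B x] by simp
  moreover have "B *\<^sub>v x \<in> carrier_vec n"
    using B x by simp
  ultimately show "y \<in> im A"
    using im_eq_range[OF A] by auto
qed

lemma im_mult_invertible:
  assumes A: "A \<in> carrier_mat m n" and P: "P \<in> carrier_mat n n" and inv: "invertible_mat P"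
  shows "im (A * P) = im A"
proof
  show "im (A * P) \<subseteq> im A"
    by (rule im_mult_subset[OF A P])
next
  obtain Q where "inverts_mat P Q" and "inverts_mat Q P"
    using inv unfolding invertible_mat_def by blast
  then have PQ: "P * Q = 1\<^sub>m n" and QP: "Q * P = 1\<^sub>m (dim_row Q)"
    using P by (auto simp: inverts_mat_def)
  \<comment> \<open>Inversion does not presuppose the shape of \<open>Q\<close>; the two products determine it.\<close>
  have Q: "Q \<in> carrier_mat n n"
    using arg_cong[OF PQ, of dim_col] arg_cong[OF QP, of dim_col] P by auto
  have "A * P * Q = A"
    using A by (simp add: assoc_mult_mat[OF A P Q] PQ)
  then show "im A \<subseteq> im (A * P)"
    using im_mult_subset[OF mult_carrier_mat[OF A P] Q] by simp
qed

theorem lemma2: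
  fixes H H' P P' :: "real mat" and m n m' n' :: nat
    and d :: "nat \<Rightarrow> real vec set \<Rightarrow> nat \<Rightarrow> real vec set \<Rightarrow> real"
  assumes "H \<in> carrier_mat m n" and "H \<noteq> 0\<^sub>m m n"
    and "H' \<in> carrier_mat m' n'" and "H' \<noteq> 0\<^sub>m m' n'"
    and "d \<in> {dist_chordal, dist_grassmann, dist_procrustes}"
    and "P \<in> carrier_mat n n" and "invertible_mat P"
    and "P' \<in> carrier_mat n' n'" and "invertible_mat P'"
  shows "d m (im (H * P)) m' (im (H' * P')) = d m (im H) m' (im H')"
  using im_mult_invertible[OF assms(1,6,7)] im_mult_invertible[OF assms(3,8,9)] by simp

end
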